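(* Let $\mathbf t=(t_0,u_0,t_1,u_1)\in\mathbb C^4$ satisfy the standing conditions listed in the context. The non-symmetric Wilson function $\mathcal E(x,\lambda)=\mathcal E(x,\lambda;\mathbf t)$ satisfies: (a) $\displaystyle\mathcal E(x,\gamma)=\frac{\Gamma(1-a-d)}{\Gamma(a+b)\Gamma(a+c)}\,E(x,-\gamma)$ for all $\gamma\in\{-\gamma_m:m\in\mathbb Z_{\ge0}\}$; (b) $\mathcal E(x,\lambda)=\mathcal E_\sigma(\lambda,x)$, where $\mathcal E_\sigma=\mathcal E(\cdot,\cdot;\mathbf t^\sigma)$ is the Wilson function for $\mathbf t^\sigma=(u_1,u_0,t_1,t_0)$.
   Context: $\mathbb N=\{1,2,\dots\}$; $\Gamma(\cdot)$ is the Gamma function and $\Gamma(\alpha\pm\beta)=\Gamma(\alpha+\beta)\Gamma(\alpha-\beta)$. Parameters. For $\mathbf t=(t_0,u_0,t_1,u_1)$: $(a,b,c,d)=(t_1+u_1,t_1-u_1,t_0+u_0+\frac12,t_0-u_0+\frac12)$ and $(\tilde a,\tilde b,\tilde c,\tilde d)=(t_1+t_0,t_1-t_0,u_1+u_0+\frac12,u_1-u_0+\frac12)$ (replacing $\mathbf t$ by $\mathbf t^\sigma$ interchanges the two 4-tuples). Standing conditions on $\mathbf t$: $t_0,t_1\ne0$; $t_0+t_1\notin-\frac12\mathbb N$; $a,b,c,d\notin-\frac12\mathbb Z_{\ge0}$; the pairwise sums of $a,b,c,d$ are not in $\mathbb Z$. Wilson polynomials. On $\mathbb C[x]$ let $(T_0f)(x)=t_0f(x)+\frac{(c-x)(d-x)}{1-2x}(f(1-x)-f(x))$,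 $(T_1f)(x)=t_1f(x)+\frac{(a+x)(b+x)}{2x}(f(-x)-f(x))$, $Y=T_0+T_1$. Put $\gamma_{2n}=t_0+t_1+n$ ($n\ge0$), $\gamma_{2n-1}=-(t_0+t_1+n)$ ($n\ge1$); $p_m$ is the unique monic polynomial of degree $m$ with $Yp_m=\gamma_mp_m$ (the non-symmetric Wilson polynomial); $E(x,\gamma_m)=p_m(x)/p_m(-a)$. Wilson function. Let $$\phi_\lambda(x;\mathbf t)=\frac{\Gamma(1-a-d)}{\Gamma(a+b)\Gamma(a+c)\Gamma(1-d\pm x)\Gamma(1-\tilde d\pm\lambda)}\,{}_4F_3\left(\begin{matrix}a+x,a-x,\tilde a+\lambda,\tilde a-\lambda\\ a+b,a+c,a+d\end{matrix};1\right)$$ $$+\frac{\Gamma(a+d-1)}{\Gamma(1+b-d)\Gamma(1+c-d)\Gamma(a\pm x)\Gamma(\tilde a\pm\lambda)}\,{}_4F_3\left(\begin{matrix}1-d+x,1-d-x,1-\tilde d+\lambda,1-\tilde d-\lambda\\ 1+b-d,1+c-d,2-a-d\end{matrix};1\right),$$ where ${}_4F_3$ is the standard hypergeometric series. Put $\delta(x)=(a+x)(b+x)$, $\delta_\sigma(\lambda)=(\tilde a+\lambda)(\tilde b+\lambda)$, and $$\mathcal E(x,\lambda;\mathbf t)=\Gamma(1-d\pm x)\,\Gamma(1-\tilde d\pm\lambda)\Big(\phi_\lambda(x;\mathbf t)+\delta(x)\delta_\sigma(\lambda)\,\phi_\lambda(x;t_0,u_0,t_1+1,u_1)\Big),$$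 where $\phi_\lambda(x;t_0,u_0,t_1+1,u_1)$ is $\phi_\lambda$ with $a,b,\tilde a,\tilde b$ replaced by $a+1,b+1,\tilde a+1,\tilde b+1$. *)

theory Defs
  imports "HOL-Analysis.Analysis" "HOL-Computational_Algebra.Polynomial"
begin

datatype wparams = WParams (pt0: complex) (pu0: complex) (pt1: complex) (pu1: complex)

definition wsigma :: "wparams \<Rightarrow> wparams" where
  "wsigma t = WParams (pu1 t) (pu0 t) (pt1 t) (pt0 t)"

definition shift1 :: "wparams \<Rightarrow> wparams" where
  "shift1 t = WParams (pt0 t) (pu0 t) (pt1 t + 1) (pu1 t)"

definition wa :: "wparams \<Rightarrow> complex" where "wa t = pt1 t + pu1 t"
definition wb :: "wparams \<Rightarrow> complex" where "wb t = pt1 t - pu1 t"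
definition wc :: "wparams \<Rightarrow> complex" where "wc t = pt0 t + pu0 t + 1/2"
definition wd :: "wparams \<Rightarrow> complex" where "wd t = pt0 t - pu0 t + 1/2"

text \<open>The dual parameters (written with a tilde in the literature).\<close>

definition da :: "wparams \<Rightarrow> complex" where "da t = pt1 t + pt0 t"
definition db :: "wparams \<Rightarrow> complex" where "db t = pt1 t - pt0 t"
definition dc :: "wparams \<Rightarrow> complex" where "dc t = pu1 t + pu0 t + 1/2"
definition dd :: "wparams \<Rightarrow> complex" where "dd t = pu1 t - pu0 t + 1/2"

lemma dual_params_sigma:
  "wa (wsigma t) = da t" "wb (wsigma t) = db t" "wc (wsigma t) = dc t" "wd (wsigma t) = dd t"
  "da (wsigma t) = wa t" "db (wsigma t) = wb t" "dc (wsigma t) = wc t" "dd (wsigma t) = wd t"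
  by (simp_all add: wsigma_def wa_def wb_def wc_def wd_def da_def db_def dc_def dd_def)

lemma params_shift1:
  "wa (shift1 t) = wa t + 1" "wb (shift1 t) = wb t + 1"
  "wc (shift1 t) = wc t" "wd (shift1 t) = wd t"
  "da (shift1 t) = da t + 1" "db (shift1 t) = db t + 1"
  "dc (shift1 t) = dc t" "dd (shift1 t) = dd t"
  by (simp_all add: shift1_def wa_def wb_def wc_def wd_def da_def db_def dc_def dd_def)

text \<open>Pairwise sums are sums of two different members of the tuple \<open>(a, b, c, d)\<close>.\<close>

definition standing_conditions :: "wparams \<Rightarrow> bool" where
  "standing_conditions t \<longleftrightarrow>
     pt0 t \<noteq> 0 \<and> pt1 t \<noteq> 0 \<and>
     (\<forall>n::nat. n \<ge> 1 \<longrightarrow> pt0 t + pt1 t \<noteq> - of_nat n / 2) \<and>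
     (\<forall>n::nat. wa t \<noteq> - of_nat n / 2 \<and> wb t \<noteq> - of_nat n / 2 \<and>
               wc t \<noteq> - of_nat n / 2 \<and> wd t \<noteq> - of_nat n / 2) \<and>
     wa t + wb t \<notin> \<int> \<and> wa t + wc t \<notin> \<int> \<and> wa t + wd t \<notin> \<int> \<and>
     wb t + wc t \<notin> \<int> \<and> wb t + wd t \<notin> \<int> \<and> wc t + wd t \<notin> \<int>"


section \<open>Non-symmetric Wilson polynomials\<close>

text \<open>
  The divisions below are exact: the numerators vanish at \<open>1/2\<close> and at \<open>0\<close>, respectively; see
  \<open>poly_wilson_T0\<close> and \<open>poly_wilson_T1\<close>.
\<close>

definition wilson_T0 :: "wparams \<Rightarrow> complex poly \<Rightarrow> complex poly" where
  "wilson_T0 t f = smult (pt0 t) f +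
     [:wc t, -1:] * [:wd t, -1:] * ((pcompose f [:1, -1:] - f) div [:1, -2:])"

definition wilson_T1 :: "wparams \<Rightarrow> complex poly \<Rightarrow> complex poly" where
  "wilson_T1 t f = smult (pt1 t) f +
     [:wa t, 1:] * [:wb t, 1:] * ((pcompose f [:0, -1:] - f) div [:0, 2:])"

lemma poly_wilson_T0:
  assumes "x \<noteq> 1/2"
  shows "poly (wilson_T0 t f) x = pt0 t * poly f x +
           (wc t - x) * (wd t - x) / (1 - 2 * x) * (poly f (1 - x) - poly f x)"
proof -
  define g where "g = pcompose f [:1, -1:] - f"
  have "poly g (1/2) = 0" by (simp add: g_def poly_pcompose)
  then have "[:-(1/2), 1:] dvd g" by (simp add: poly_eq_0_iff_dvd)
  moreover have "[:1, -2:] = smult (-2) [:-(1/2), 1::complex:]" by simp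
  ultimately have "[:1, -2:] dvd g" by (metis smult_dvd_iff neg_equal_0_iff_equal zero_neq_numeral)
  then have "g = g div [:1, -2:] * [:1, -2:]" by (rule dvd_div_mult_self[symmetric])
  then have "poly g x = poly (g div [:1, -2:] * [:1, -2:]) x" by (rule arg_cong)
  then have "poly g x = poly (g div [:1, -2:]) x * (1 - 2 * x)"
    by (simp only: poly_mult) (simp add: algebra_simps)
  moreover have "1 - 2 * x \<noteq> 0" using assms by (auto simp: field_simps)
  ultimately have div: "poly (g div [:1, -2:]) x = poly g x / (1 - 2 * x)" by (simp add: field_simps)
  have g: "poly g x = poly f (1 - x) - poly f x" by (simp add: g_def poly_pcompose)
  have lin: "poly [:wc t, -1:] x = wc t - x" "poly [:wd t, -1:] x = wd t - x" by simp_all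
  show ?thesis
    unfolding wilson_T0_def g_def[symmetric] poly_add poly_mult poly_smult div g lin by simp
qed

lemma poly_wilson_T1:
  assumes "x \<noteq> 0"
  shows "poly (wilson_T1 t f) x = pt1 t * poly f x +
           (wa t + x) * (wb t + x) / (2 * x) * (poly f (- x) - poly f x)"
proof -
  define g where "g = pcompose f [:0, -1:] - f"
  have "poly g 0 = 0" by (simp add: g_def poly_pcompose)
  then have "[:0, 1:] dvd g" by (simp add: poly_eq_0_iff_dvd)
  moreover have "[:0, 2:] = smult 2 [:0, 1::complex:]" by simp
  ultimately have "[:0, 2:] dvd g" by (metis smult_dvd_iff zero_neq_numeral)
  then have "g = g div [:0, 2:] * [:0, 2:]" by (rule dvd_div_mult_self[symmetric])
  then have "poly g x = poly (g div [:0, 2:] * [:0, 2:]) x" by (rule arg_cong)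
  then have "poly g x = poly (g div [:0, 2:]) x * (2 * x)"
    by (simp only: poly_mult) (simp add: algebra_simps)
  then have div: "poly (g div [:0, 2:]) x = poly g x / (2 * x)" using assms by (simp add: field_simps)
  have g: "poly g x = poly f (- x) - poly f x" by (simp add: g_def poly_pcompose)
  have lin: "poly [:wa t, 1:] x = wa t + x" "poly [:wb t, 1:] x = wb t + x" by simp_all
  show ?thesis
    unfolding wilson_T1_def g_def[symmetric] poly_add poly_mult poly_smult div g lin by simp
qed

definition wilson_Y :: "wparams \<Rightarrow> complex poly \<Rightarrow> complex poly" where
  "wilson_Y t f = wilson_T0 t f + wilson_T1 t f"

definition wgamma :: "wparams \<Rightarrow> nat \<Rightarrow> complex" where
  "wgamma t m = (if even m then pt0 t + pt1 t + of_nat (m div 2)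
                 else - (pt0 t + pt1 t + of_nat ((m + 1) div 2)))"

definition wilson_poly :: "wparams \<Rightarrow> nat \<Rightarrow> complex poly" where
  "wilson_poly t m = (THE p. lead_coeff p = 1 \<and> degree p = m \<and> wilson_Y t p = smult (wgamma t m) p)"

text \<open>
  As a function of the spectral variable, the normalized polynomial is only meaningful on
  \<open>range (wgamma t)\<close>; the index is unique because \<open>t\<^sub>0 + t\<^sub>1 \<notin> -\<nat>/2\<close> makes \<open>wgamma t\<close> injective.
\<close>

definition wilson_E :: "wparams \<Rightarrow> complex \<Rightarrow> complex \<Rightarrow> complex" where
  "wilson_E t x g = (let p = wilson_poly t (THE m. wgamma t m = g) in poly p x / poly p (- wa t))"


section \<open>The non-symmetric Wilson function\<close>

definition hyp4F3 ::
  "complex \<Rightarrow> complex \<Rightarrow> complex \<Rightarrow> complex \<Rightarrow> complex \<Rightarrow> complex \<Rightarrow> complex \<Rightarrow> complex \<Rightarrow> complex" where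
  "hyp4F3 a1 a2 a3 a4 b1 b2 b3 z = eval_fps (fps_hypergeo [a1, a2, a3, a4] [b1, b2, b3] 1) z"

text \<open>
  The quotient of the series by \<open>\<Gamma>(b1) \<Gamma>(b2)\<close>, continued to all values of \<open>b1\<close> and \<open>b2\<close>.
  The conditions on the parameters do not prevent \<open>1 + b - d\<close> or \<open>1 + c - d\<close> from being a
  nonpositive integer, where the second summand of the Wilson function has to be read in this way.
\<close>

definition hyp4F3_reg ::
  "complex \<Rightarrow> complex \<Rightarrow> complex \<Rightarrow> complex \<Rightarrow> complex \<Rightarrow> complex \<Rightarrow> complex \<Rightarrow> complex \<Rightarrow> complex" where
  "hyp4F3_reg a1 a2 a3 a4 b1 b2 b3 z =
     (\<Sum>n. pochhammer a1 n * pochhammer a2 n * pochhammer a3 n * pochhammer a4 n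
            * rGamma (b1 + of_nat n) * rGamma (b2 + of_nat n)
            / (pochhammer b3 n * fact n) * z ^ n)"

lemma hyp4F3_reg_eq:
  assumes "b1 \<notin> \<int>\<^sub>\<le>\<^sub>0" "b2 \<notin> \<int>\<^sub>\<le>\<^sub>0"
    and "summable (\<lambda>n. fps_nth (fps_hypergeo [a1, a2, a3, a4] [b1, b2, b3] 1) n * z ^ n)"
  shows "hyp4F3_reg a1 a2 a3 a4 b1 b2 b3 z = hyp4F3 a1 a2 a3 a4 b1 b2 b3 z / (Gamma b1 * Gamma b2)"
proof -
  let ?u = "\<lambda>n. fps_nth (fps_hypergeo [a1, a2, a3, a4] [b1, b2, b3] 1) n * z ^ n"
  define C where "C = Gamma b1 * Gamma b2"
  have *: "rGamma (b + of_nat n) = 1 / (Gamma b * pochhammer b n)"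
    if "b \<notin> \<int>\<^sub>\<le>\<^sub>0" for b :: complex and n
  proof -
    have "Gamma (b + of_nat n) = Gamma b * pochhammer b n"
      using pochhammer_Gamma[OF that, of n] that by (simp add: field_simps Gamma_eq_zero_iff)
    then show ?thesis by (simp add: rGamma_inverse_Gamma inverse_eq_divide)
  qed
  have "hyp4F3_reg a1 a2 a3 a4 b1 b2 b3 z = (\<Sum>n. ?u n / C)"
    unfolding hyp4F3_reg_def C_def using assms(1,2) by (intro suminf_cong) (simp add: * field_simps)
  also have "\<dots> = (\<Sum>n. ?u n) / C"
    using assms(3) by (rule suminf_divide)
  finally show ?thesis by (simp add: hyp4F3_def eval_fps_def C_def)
qed

definition wilson_phi :: "wparams \<Rightarrow> complex \<Rightarrow> complex \<Rightarrow> complex" where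
  "wilson_phi t l x =
     (let a = wa t; b = wb t; c = wc t; d = wd t; a' = da t; d' = dd t in
      Gamma (1 - a - d) / (Gamma (a + b) * Gamma (a + c))
        * rGamma (1 - d + x) * rGamma (1 - d - x) * rGamma (1 - d' + l) * rGamma (1 - d' - l)
        * hyp4F3 (a + x) (a - x) (a' + l) (a' - l) (a + b) (a + c) (a + d) 1
      + Gamma (a + d - 1)
        * rGamma (a + x) * rGamma (a - x) * rGamma (a' + l) * rGamma (a' - l)
        * hyp4F3_reg (1 - d + x) (1 - d - x) (1 - d' + l) (1 - d' - l)
            (1 + b - d) (1 + c - d) (2 - a - d) 1)"

text \<open>
  Since \<open>Gamma\<close> is \<open>0\<close> at its poles, this is the meromorphic function of \<open>x\<close> and \<open>l\<close> only where
  none of \<open>1 - d \<plusminus> x\<close> and \<open>1 - d' \<plusminus> l\<close> is a nonpositive integer.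
\<close>

definition wilson_fun :: "wparams \<Rightarrow> complex \<Rightarrow> complex \<Rightarrow> complex" where
  "wilson_fun t x l =
     Gamma (1 - wd t + x) * Gamma (1 - wd t - x) * Gamma (1 - dd t + l) * Gamma (1 - dd t - l)
     * (wilson_phi t l x
        + (wa t + x) * (wb t + x) * ((da t + l) * (db t + l)) * wilson_phi (shift1 t) l x)"

end

theory Submission
  imports Defs
begin

text \<open>
  At \<open>\<lambda> = -\<gamma>\<^sub>m\<close> the second summands of the two functions \<open>\<phi>\<close> carry a vanishing reciprocal Gamma factor
  and the remaining series terminate, so that \<open>\<E>(x, \<lambda>)\<close> is, up to the constant in (a), a combination of
  \<open>(a + x)\<^sub>k (a - x)\<^sub>k\<close> and \<open>\<delta>(x) (a + 1 + x)\<^sub>k (a + 1 - x)\<^sub>k\<close>. If the \<open>k\<close>-th term of the first series is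
  paired with the \<open>(k-1)\<close>-st of the second, then \<open>Y + \<lambda>\<close> maps each pair to a difference of consecutive
  multiples of \<open>(a + x)\<^sub>k (a + 1 - x)\<^sub>k\<close>; the sum telescopes to a multiple of \<open>(a + n)\<^sup>2 - \<lambda>\<^sup>2\<close> with the
  dual \<open>a\<close>, which is \<open>0\<close>. The sum has degree \<open>m\<close> and takes the value \<open>1\<close> at \<open>-a\<close>, and the eigenvalues
  \<open>\<gamma>\<^sub>m\<close> are distinct, so it is \<open>p\<^sub>m / p\<^sub>m(-a)\<close>. Part (b) holds because the parameters of both series and
  all prefactors are permuted by the duality.
\<close>

section \<open>Pointwise form and linearity of \<open>Y\<close>\<close>

text \<open>The pointwise formula for \<open>wilson_Y\<close> is singular at \<open>0\<close> and
  \<open>1/2\<close>; this lifts identities checked elsewhere to polynomials.\<close>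

lemma poly_eqI_off_finite:
  fixes p q :: "'a :: {idom, ring_char_0} poly"
  assumes "finite S" "\<And>x. x \<notin> S \<Longrightarrow> poly p x = poly q x"
  shows "p = q"
proof (rule ccontr)
  assume "p \<noteq> q"
  then have "finite {x. poly (p - q) x = 0}" by (intro poly_roots_finite) simp
  moreover have "- S \<subseteq> {x. poly (p - q) x = 0}" using assms(2) by auto
  ultimately have "finite (- S)" by (rule finite_subset[rotated])
  with assms(1) show False using infinite_UNIV_char_0 by (metis finite_compl)
qed

lemma poly_wilson_Y:
  assumes "x \<notin> {0, 1/2}"
  shows "poly (wilson_Y t f) x = da t * poly f x
           + (wc t - x) * (wd t - x) / (1 - 2 * x) * (poly f (1 - x) - poly f x)
           + (wa t + x) * (wb t + x) / (2 * x) * (poly f (- x) - poly f x)"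
  using assms by (simp add: wilson_Y_def poly_wilson_T0 poly_wilson_T1 da_def algebra_simps)

text \<open>The coefficients are independent of \<open>f\<close>, so linearity of
  \<open>wilson_Y\<close> follows without handling polynomial division.\<close>

lemma poly_wilson_Y_linear:
  assumes "x \<notin> {0, 1/2}"
  obtains u v w where "\<And>f. poly (wilson_Y t f) x = u * poly f x + v * poly f (1 - x) + w * poly f (- x)"
proof
  define v where "v = (wc t - x) * (wd t - x) / (1 - 2 * x)"
  define w where "w = (wa t + x) * (wb t + x) / (2 * x)"
  show "poly (wilson_Y t f) x = (da t - v - w) * poly f x + v * poly f (1 - x) + w * poly f (- x)" for f
    unfolding poly_wilson_Y[OF assms] v_def[symmetric] w_def[symmetric] by (simp add: algebra_simps)
qed

lemma wilson_Y_add: "wilson_Y t (f + g) = wilson_Y t f + wilson_Y t g"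
proof (rule poly_eqI_off_finite[of "{0, 1/2}"])
  fix x :: complex assume "x \<notin> {0, 1/2}"
  then show "poly (wilson_Y t (f + g)) x = poly (wilson_Y t f + wilson_Y t g) x"
    by (rule poly_wilson_Y_linear[of x t]) (simp add: distrib_left)
qed simp

lemma wilson_Y_smult: "wilson_Y t (smult k f) = smult k (wilson_Y t f)"
proof (rule poly_eqI_off_finite[of "{0, 1/2}"])
  fix x :: complex assume "x \<notin> {0, 1/2}"
  then show "poly (wilson_Y t (smult k f)) x = poly (smult k (wilson_Y t f)) x"
    by (rule poly_wilson_Y_linear[of x t]) (simp add: distrib_left mult_ac)
qed simp

lemma wilson_Y_diff: "wilson_Y t (f - g) = wilson_Y t f - wilson_Y t g"
  using wilson_Y_add[of t f "smult (-1) g"] unfolding wilson_Y_smult by simp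

section \<open>The paired terms and their partial sums\<close>

text \<open>The basis is invariant under \<open>x \<mapsto> 1 - x\<close>, so that \<open>T\<^sub>0\<close> acts on it by the scalar \<open>t\<^sub>0\<close>.\<close>

definition wbase :: "wparams \<Rightarrow> nat \<Rightarrow> complex poly" where
  "wbase t k = (\<Prod>i<k. [:wa t + of_nat i, 1:] * [:wa t + 1 + of_nat i, -1:])"

lemma poly_wbase: "poly (wbase t k) x = pochhammer (wa t + x) k * pochhammer (wa t + 1 - x) k"
  unfolding wbase_def poly_prod pochhammer_prod atLeast0LessThan prod.distrib[symmetric]
  by (intro prod.cong) (simp_all add: algebra_simps)

lemma degree_wbase: "degree (wbase t k) = 2 * k" and wbase_nonzero: "wbase t k \<noteq> 0"
proof -
  show nz: "wbase t k \<noteq> 0" by (auto simp: wbase_def)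
  show "degree (wbase t k) = 2 * k"
    unfolding wbase_def by (subst degree_prod_sum_eq) (auto simp: degree_mult_eq)
qed

text \<open>Coefficient of the first \<open>4F3\<close> series, without the two Pochhammer symbols
  that contain \<open>x\<close>.\<close>

definition wcoeff :: "wparams \<Rightarrow> complex \<Rightarrow> nat \<Rightarrow> complex" where
  "wcoeff t l k = pochhammer (da t + l) k * pochhammer (da t - l) k /
     (pochhammer (wa t + wb t) k * pochhammer (wa t + wc t) k * pochhammer (wa t + wd t) k * fact k)"

text \<open>Coefficient of the shifted series, brought to the Gamma prefactor of the unshifted one
  (see \<open>wcoeff'_shift\<close>) and written through its partner
  \<open>wcoeff t l (Suc k)\<close>. The factor \<open>da t - l\<close> cancels against that
  partner; at \<open>l = da t\<close> the quotient takes the default value \<open>0\<close>.\<close>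

definition wcoeff' :: "wparams \<Rightarrow> complex \<Rightarrow> nat \<Rightarrow> complex" where
  "wcoeff' t l k = - (of_nat (Suc k) * (db t + l) * wcoeff t l (Suc k)) /
     ((da t - l) * (wa t + wb t + of_nat (Suc k)))"

text \<open>Index \<open>Suc k\<close> of the first series paired with index \<open>k\<close> of the
  second, after extraction of the common factor
  \<open>pochhammer (wa t + x) (Suc k) * pochhammer (wa t + 1 - x) k\<close>.\<close>

definition wterm :: "wparams \<Rightarrow> complex \<Rightarrow> nat \<Rightarrow> complex poly" where
  "wterm t l k = wbase t k * [:wa t + of_nat k, 1:] *
     (smult (wcoeff t l (Suc k)) [:wa t, -1:] + smult (wcoeff' t l k) [:wb t, 1:])"

definition wsum :: "wparams \<Rightarrow> complex \<Rightarrow> nat \<Rightarrow> complex poly" where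
  "wsum t l n = 1 + (\<Sum>k<n. wterm t l k)"

lemma wsum_0 [simp]: "wsum t l 0 = 1" and wsum_Suc: "wsum t l (Suc n) = wsum t l n + wterm t l n"
  by (simp_all add: wsum_def)

text \<open>Undoes the pairing, for comparison with the hypergeometric series; the unpaired initial
  \<open>1\<close> is the extra term of the first sum.\<close>

lemma poly_wsum:
  "poly (wsum t l n) x =
     (\<Sum>k\<le>n. wcoeff t l k * (pochhammer (wa t + x) k * pochhammer (wa t - x) k))
     + (wa t + x) * (wb t + x) *
       (\<Sum>k<n. wcoeff' t l k * (pochhammer (wa t + 1 + x) k * pochhammer (wa t + 1 - x) k))"
proof (induction n)
  case 0
  show ?case by (simp add: wcoeff_def)
next
  case (Suc n)
  have 1: "pochhammer (wa t - x) (Suc n) = (wa t - x) * pochhammer (wa t + 1 - x) n"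
    by (simp add: pochhammer_rec algebra_simps)
  have 2: "(wa t + x) * pochhammer (wa t + 1 + x) n = pochhammer (wa t + x) n * (wa t + of_nat n + x)"
    using pochhammer_rec[of "wa t + x" n] pochhammer_rec'[of "wa t + x" n] by (simp add: algebra_simps)
  have 3: "pochhammer (wa t + x) (Suc n) = pochhammer (wa t + x) n * (wa t + of_nat n + x)"
    by (simp add: pochhammer_rec' algebra_simps)
  have "poly (wterm t l n) x = wcoeff t l (Suc n) * (pochhammer (wa t + x) (Suc n) * pochhammer (wa t - x) (Suc n))
      + (wb t + x) * wcoeff' t l n * ((wa t + x) * pochhammer (wa t + 1 + x) n) * pochhammer (wa t + 1 - x) n"
    unfolding 1 2 3 by (simp add: wterm_def poly_wbase algebra_simps)
  then show ?case using Suc by (simp add: wsum_Suc algebra_simps)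
qed

lemma wsum_at_minus_a: "poly (wsum t l n) (- wa t) = 1"
proof -
  have "(\<Sum>k\<le>n. wcoeff t l k * (pochhammer (0::complex) k * pochhammer (wa t + wa t) k)) = (\<Sum>k\<le>n. if k = 0 then 1 else 0)"
    by (intro sum.cong) (auto simp: wcoeff_def pochhammer_0_left)
  then show ?thesis by (simp add: poly_wsum)
qed

section \<open>Telescoping of \<open>Y + l\<close> along the partial sums\<close>

lemma wcoeff_Suc:
  assumes "standing_conditions t"
  shows "of_nat (Suc k) * (wa t + wb t + of_nat k) * (wa t + wc t + of_nat k) * (wa t + wd t + of_nat k)
           * wcoeff t l (Suc k) = ((da t + of_nat k)^2 - l^2) * wcoeff t l k"
proof -
  have nz: "z + of_nat k \<noteq> 0" if "z \<notin> \<int>" for z :: complex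
    using that by (metis add.commute add_eq_0_iff Ints_minus Ints_of_nat)
  have "wa t + wb t + of_nat k \<noteq> 0" "wa t + wc t + of_nat k \<noteq> 0" "wa t + wd t + of_nat k \<noteq> 0"
    using assms by (auto simp: standing_conditions_def intro!: nz)
  moreover have "of_nat (Suc k) \<noteq> (0::complex)" by (simp del: of_nat_Suc)
  ultimately show ?thesis
    by (simp add: wcoeff_def pochhammer_rec' divide_simps del: of_nat_Suc)
       (simp add: algebra_simps power2_eq_square)
qed

text \<open>
  Here \<open>K\<close> and \<open>M\<close> are the two coefficients in \<open>wterm\<close>, up to the common factor \<open>\<kappa>\<close> that clears the
  denominator of \<open>wcoeff'\<close>.
\<close>

lemma Y_wterm_identity:
  fixes a b c d x l \<kappa> N r r' :: complex
  defines "A \<equiv> (a + b) / 2 + (c + d - 1) / 2" and "B \<equiv> (a + b) / 2 - (c + d - 1) / 2"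
  defines "K \<equiv> \<kappa> * (A - l) * (a + b + N + 1)" and "M \<equiv> - (\<kappa> * (N + 1) * (B + l))"
  assumes x: "x \<notin> {0, 1/2}"
    and r': "(a + x) * (a + N - x) * r' = (a - x) * (a + N + x) * r"
  shows "(A + l) * (r * (a + N + x) * (K * (a - x) + M * (b + x)))
     + (c - x) * (d - x) / (1 - 2 * x) *
         (r * (a + N + 1 - x) * (K * (a - 1 + x) + M * (b + 1 - x)) - r * (a + N + x) * (K * (a - x) + M * (b + x)))
     + (a + x) * (b + x) / (2 * x) *
         (r' * (a + N - x) * (K * (a + x) + M * (b - x)) - r * (a + N + x) * (K * (a - x) + M * (b + x)))
     = (a + b) * \<kappa> * r * (((A + N + 1)^2 - l^2) * (a + N + x) * (a + N + 1 - x)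
         - (a + b + N + 1) * (N + 1) * (a + c + N) * (a + d + N))"
proof -
  have nz: "1 - 2 * x \<noteq> 0" "x \<noteq> 0" using x by (auto simp: field_simps)
  \<comment> \<open>The value \<open>r\<close> is shared by \<open>x\<close> and
    \<open>1 - x\<close>, so the difference is divisible by \<open>1 - 2 * x\<close>.\<close>
  have "r * (a + N + 1 - x) * (K * (a - 1 + x) + M * (b + 1 - x)) - r * (a + N + x) * (K * (a - x) + M * (b + x))
     = (1 - 2 * x) * (r * (M * (a + b + N + 1) - K * (N + 1)))"
    by (simp add: algebra_simps)
  then have T0: "(c - x) * (d - x) / (1 - 2 * x) *
       (r * (a + N + 1 - x) * (K * (a - 1 + x) + M * (b + 1 - x)) - r * (a + N + x) * (K * (a - x) + M * (b + x)))
     = (c - x) * (d - x) * r * (M * (a + b + N + 1) - K * (N + 1))"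
    using nz by simp
  \<comment> \<open>Multiplication by \<open>a + x\<close> makes \<open>r'\<close> expressible
    through \<open>r\<close>, and a factor \<open>2 * x\<close> splits off.\<close>
  have "(a + x) * (r' * (a + N - x) * (K * (a + x) + M * (b - x)) - r * (a + N + x) * (K * (a - x) + M * (b + x)))
      = ((a + x) * (a + N - x) * r') * (K * (a + x) + M * (b - x))
        - (a + x) * r * (a + N + x) * (K * (a - x) + M * (b + x))"
    by (simp add: algebra_simps)
  also have "\<dots> = 2 * x * (- ((a + b) * M * (a + N + x) * r))"
    unfolding r' by (simp add: algebra_simps)
  finally have "(b + x) / (2 * x) * ((a + x) *
       (r' * (a + N - x) * (K * (a + x) + M * (b - x)) - r * (a + N + x) * (K * (a - x) + M * (b + x))))
     = (b + x) / (2 * x) * (2 * x * (- ((a + b) * M * (a + N + x) * r)))" by (rule arg_cong)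
  also have "\<dots> = - ((b + x) * (a + b) * M * (a + N + x) * r)" using nz by simp
  finally have T1: "(a + x) * (b + x) / (2 * x) *
       (r' * (a + N - x) * (K * (a + x) + M * (b - x)) - r * (a + N + x) * (K * (a - x) + M * (b + x)))
     = - ((b + x) * (a + b) * M * (a + N + x) * r)"
    by (simp only: mult.assoc mult.left_commute[of "a + x"] times_divide_eq_left times_divide_eq_right)
  have cd: "c + d = A - B + 1" and ab: "a + b = A + B" by (simp_all add: A_def B_def field_simps)
  have b: "b = A + B - a" using ab by (simp add: algebra_simps)
  have "M * (a + b + N + 1) - K * (N + 1) = - (\<kappa> * (N + 1) * (a + b + N + 1) * (A + B))"
    by (simp add: K_def M_def algebra_simps)
  then have C: "M * (a + b + N + 1) - K * (N + 1) = - (\<kappa> * (N + 1) * (a + b + N + 1) * (a + b))"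
    by (simp only: ab)
  \<comment> \<open>Division by \<open>a + N + x\<close>: the remainder is the value at
    \<open>x = - (a + N)\<close> and supplies the subtracted term of the claim.\<close>
  have "(c - x) * (d - x) = (a + N + x) * (x - (a + N + (c + d))) + (a + c + N) * (a + d + N)"
    by (simp add: algebra_simps)
  then have D: "(c - x) * (d - x) = (a + N + x) * (x - (a + N + (A - B + 1))) + (a + c + N) * (a + d + N)"
    unfolding cd .
  have E: "(A + l) * (K * (a - x) + M * (b + x)) - (b + x) * (a + b) * M
      = \<kappa> * ((A\<^sup>2 - l\<^sup>2) * (a + b + N + 1) * (a - x) + (N + 1) * (B\<^sup>2 - l\<^sup>2) * (b + x))"
    unfolding ab K_def M_def by (simp add: algebra_simps power2_eq_square)
  \<comment> \<open>A linear polynomial in \<open>x\<close> with zero \<open>a + N + 1\<close>: it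
    yields the second of the two factors by which \<open>wbase\<close> grows.\<close>
  have F: "(A\<^sup>2 - l\<^sup>2) * (a + b + N + 1) * (a - x) + (N + 1) * (B\<^sup>2 - l\<^sup>2) * (b + x)
      - (N + 1) * (a + b + N + 1) * (a + b) * (x - (a + N + (A - B + 1)))
      = (a + b) * ((A + N + 1)\<^sup>2 - l\<^sup>2) * (a + N + 1 - x)"
    unfolding ab unfolding b by (simp add: algebra_simps power2_eq_square)
  have "(A + l) * (r * (a + N + x) * (K * (a - x) + M * (b + x)))
      + (c - x) * (d - x) * r * (M * (a + b + N + 1) - K * (N + 1))
      + - ((b + x) * (a + b) * M * (a + N + x) * r)
      = r * ((a + N + x) * ((A + l) * (K * (a - x) + M * (b + x)) - (b + x) * (a + b) * M)
        + (c - x) * (d - x) * (M * (a + b + N + 1) - K * (N + 1)))"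
  proof -
    \<comment> \<open>The regrouping is done for opaque factors, so that ring normalization does not
      expand them.\<close>
    have "p * (r * q * k) + e * f * r * g + - (u * s * m * q * r) = r * (q * (p * k - u * s * m) + e * f * g)"
      for p q k e f g u s m by (simp add: algebra_simps)
    then show ?thesis by (simp only:)
  qed
  also have "\<dots> = r * ((a + N + x) * (\<kappa> * ((A\<^sup>2 - l\<^sup>2) * (a + b + N + 1) * (a - x)
         + (N + 1) * (B\<^sup>2 - l\<^sup>2) * (b + x)
         - (N + 1) * (a + b + N + 1) * (a + b) * (x - (a + N + (A - B + 1)))))
       - \<kappa> * (N + 1) * (a + b + N + 1) * (a + b) * ((a + c + N) * (a + d + N)))"
  proof -
    have "p * (\<kappa> * w) + (p * y + z) * - (\<kappa> * n * m * s) = p * (\<kappa> * (w - n * m * s * y)) - \<kappa> * n * m * s * z"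
      for p w y z n m s by (simp add: algebra_simps)
    then show ?thesis unfolding E C D by (simp only:)
  qed
  also have "\<dots> = (a + b) * \<kappa> * r * (((A + N + 1)\<^sup>2 - l\<^sup>2) * (a + N + x) * (a + N + 1 - x)
         - (a + b + N + 1) * (N + 1) * (a + c + N) * (a + d + N))"
  proof -
    have "r * (p * (\<kappa> * (s * q * z)) - \<kappa> * n * m * s * (y * w)) = s * \<kappa> * r * (q * p * z - m * n * y * w)"
      for p q z n m s y w by (simp add: algebra_simps)
    then show ?thesis unfolding F by (simp only:)
  qed
  finally show ?thesis unfolding T0 T1 .
qed

text \<open>The contributions of successive pairs cancel up to one boundary term. Once its factor
  \<open>(da t + of_nat n)^2 - l^2\<close> vanishes, \<open>wsum t l n\<close> is an eigenfunction
  with eigenvalue \<open>- l\<close>.\<close>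

lemma wsum_eigen_partial:
  assumes st: "standing_conditions t" and l: "l \<noteq> da t" and x: "x \<notin> {0, 1/2}"
  shows "poly (wilson_Y t (wsum t l n)) x + l * poly (wsum t l n) x =
     (wa t + wb t) * (((da t + of_nat n)^2 - l^2) * wcoeff t l n)
       / ((da t - l) * (wa t + wb t + of_nat n)) * poly (wbase t n) x"
proof -
  have ab: "wa t + wb t + of_nat k \<noteq> 0" for k
    using st unfolding standing_conditions_def
    by (metis add.commute add_eq_0_iff Ints_minus Ints_of_nat)
  have al: "da t - l \<noteq> 0" using l by simp
  show ?thesis
  proof (induction n)
    case 0
    show ?case using ab[of 0] al
      by (simp add: poly_wilson_Y[OF x] wcoeff_def wbase_def divide_simps)
         (simp add: algebra_simps power2_eq_square)
  next
    case (Suc n)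
    define \<kappa> where "\<kappa> = wcoeff t l (Suc n) / ((da t - l) * (wa t + wb t + of_nat n + 1))"
    have abn: "wa t + wb t + of_nat n + 1 \<noteq> 0" using ab[of "Suc n"] by (simp add: add_ac)
    have A: "da t = (wa t + wb t) / 2 + (wc t + wd t - 1) / 2"
      and B: "db t = (wa t + wb t) / 2 - (wc t + wd t - 1) / 2"
      by (simp_all add: wa_def wb_def wc_def wd_def da_def db_def field_simps)
    have K: "wcoeff t l (Suc n) = \<kappa> * (da t - l) * (wa t + wb t + of_nat n + 1)"
      using abn al by (simp add: \<kappa>_def)
    have M: "wcoeff' t l n = - (\<kappa> * (of_nat n + 1) * (db t + l))"
      using abn al by (simp add: wcoeff'_def K add_ac divide_simps)
    define r where "r = poly (wbase t n) x"
    define r' where "r' = poly (wbase t n) (- x)"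
    have r1: "poly (wbase t n) (1 - x) = r" by (simp add: r_def poly_wbase algebra_simps)
    have rS: "poly (wbase t (Suc n)) x = r * (wa t + of_nat n + x) * (wa t + of_nat n + 1 - x)"
      by (simp add: r_def wbase_def algebra_simps)
    \<comment> \<open>Passing from \<open>x\<close> to \<open>- x\<close> moves the offset
      \<open>1\<close> from one Pochhammer symbol of \<open>wbase\<close> to the other; linear
      factors on both sides avoid a division.\<close>
    have rr: "(wa t + x) * (wa t + of_nat n - x) * r' = (wa t - x) * (wa t + of_nat n + x) * r"
    proof -
      have "z * pochhammer (z + 1) n = pochhammer z n * (z + of_nat n)" for z :: complex
        using pochhammer_rec[of z n] pochhammer_rec'[of z n] by (simp add: mult_ac)
      from this[of "wa t + x"] this[of "wa t - x"]
      have *: "(wa t + x) * pochhammer (wa t + 1 + x) n = pochhammer (wa t + x) n * (wa t + of_nat n + x)"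
          "pochhammer (wa t - x) n * (wa t + of_nat n - x) = (wa t - x) * pochhammer (wa t + 1 - x) n"
        by (simp_all add: algebra_simps)
      have "(wa t + x) * (wa t + of_nat n - x) * r'
          = ((wa t + x) * pochhammer (wa t + 1 + x) n) * (pochhammer (wa t - x) n * (wa t + of_nat n - x))"
        by (simp add: r'_def poly_wbase)
      also have "\<dots> = (wa t - x) * (wa t + of_nat n + x) * r"
        unfolding * by (simp add: r_def poly_wbase)
      finally show ?thesis .
    qed
    define q where "q = wterm t l n"
    have q: "poly q x = r * (wa t + of_nat n + x) * (wcoeff t l (Suc n) * (wa t - x) + wcoeff' t l n * (wb t + x))"
       "poly q (1 - x) = r * (wa t + of_nat n + 1 - x) * (wcoeff t l (Suc n) * (wa t - 1 + x) + wcoeff' t l n * (wb t + 1 - x))"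
       "poly q (- x) = r' * (wa t + of_nat n - x) * (wcoeff t l (Suc n) * (wa t + x) + wcoeff' t l n * (wb t - x))"
      unfolding q_def wterm_def poly_mult r1 r_def[symmetric] r'_def[symmetric]
      by (simp_all add: algebra_simps)
    have step: "poly (wilson_Y t q) x + l * poly q x = (wa t + wb t) * \<kappa> * r *
        (((da t + of_nat n + 1)^2 - l^2) * (wa t + of_nat n + x) * (wa t + of_nat n + 1 - x)
         - (wa t + wb t + of_nat n + 1) * (of_nat n + 1) * (wa t + wc t + of_nat n) * (wa t + wd t + of_nat n))"
      unfolding poly_wilson_Y[OF x] q K M A B
      using Y_wterm_identity[OF x rr, where c = "wc t" and d = "wd t" and b = "wb t" and \<kappa> = \<kappa> and l = l]
      by (simp add: distrib_right add_ac)
    have "poly (wilson_Y t (wsum t l (Suc n))) x + l * poly (wsum t l (Suc n)) x =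
       (poly (wilson_Y t (wsum t l n)) x + l * poly (wsum t l n) x) + (poly (wilson_Y t q) x + l * poly q x)"
      by (simp add: wsum_Suc wilson_Y_add q_def algebra_simps)
    \<comment> \<open>The recurrence for \<open>wcoeff\<close> turns the boundary term of index
      \<open>n\<close> into the term subtracted in \<open>step\<close>, so the two cancel.\<close>
    also have "poly (wilson_Y t (wsum t l n)) x + l * poly (wsum t l n) x =
        (wa t + wb t) * \<kappa> * r * ((wa t + wb t + of_nat n + 1) * (of_nat n + 1) * (wa t + wc t + of_nat n) * (wa t + wd t + of_nat n))"
      unfolding Suc wcoeff_Suc[OF st, symmetric] K r_def[symmetric]
      using al ab[of n] by (simp add: divide_simps)
    finally have "poly (wilson_Y t (wsum t l (Suc n))) x + l * poly (wsum t l (Suc n)) x =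
        (wa t + wb t) * \<kappa> * r * (((da t + of_nat n + 1)^2 - l^2) * (wa t + of_nat n + x) * (wa t + of_nat n + 1 - x))"
      unfolding step by (simp add: algebra_simps)
    also have "\<dots> = (wa t + wb t) * (((da t + of_nat (Suc n))^2 - l^2) * wcoeff t l (Suc n))
       / ((da t - l) * (wa t + wb t + of_nat (Suc n))) * poly (wbase t (Suc n)) x"
      unfolding rS K using al abn by (simp add: add_ac)
    finally show ?case .
  qed
qed

section \<open>Polynomial eigenfunctions, their eigenvalues and degrees\<close>

text \<open>For \<open>m = 2 * n\<close> and \<open>m = 2 * n - 1\<close> the number of pairs is
  \<open>n\<close>, the index at which the boundary term vanishes for
  \<open>l = - wgamma t m\<close>.\<close>

definition wpoly :: "wparams \<Rightarrow> nat \<Rightarrow> complex poly" where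
  "wpoly t m = wsum t (- wgamma t m) ((m + 1) div 2)"

lemma da_ne_half:
  assumes "standing_conditions t" "k > 0"
  shows "2 * da t + of_nat k \<noteq> 0"
proof
  assume "2 * da t + of_nat k = 0"
  then have "pt0 t + pt1 t = - of_nat k / 2" by (simp add: da_def field_simps eq_neg_iff_add_eq_0)
  moreover have "\<forall>n::nat. n \<ge> 1 \<longrightarrow> pt0 t + pt1 t \<noteq> - of_nat n / 2"
    using assms(1) unfolding standing_conditions_def by blast
  ultimately show False using assms(2) by (metis Suc_leI One_nat_def)
qed

lemma da_ne_int:
  assumes "standing_conditions t" "k > 0"
  shows "da t + of_nat k \<noteq> 0"
proof -
  have "2 * da t + of_nat (2 * k) = 2 * (da t + of_nat k)" by (simp add: distrib_left)
  with da_ne_half[OF assms(1), of "2 * k"] assms(2) show ?thesis by (metis mult_zero_right nat_0_less_mult_iff zero_less_numeral)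
qed

lemma wgamma_even: "wgamma t (2 * n) = da t + of_nat n"
  and wgamma_odd: "wgamma t (2 * n + 1) = - (da t + of_nat (Suc n))"
  by (simp_all add: wgamma_def da_def)

text \<open>Equal parity is immediate; for opposite parity a coincidence would make
  \<open>2 * da t\<close> a negative integer, which the standing conditions exclude.\<close>

lemma wgamma_inj:
  assumes st: "standing_conditions t"
  shows "wgamma t m = wgamma t k \<longleftrightarrow> m = k"
proof
  have mixed: "wgamma t (2 * i) \<noteq> wgamma t (2 * j + 1)" for i j
  proof
    assume "wgamma t (2 * i) = wgamma t (2 * j + 1)"
    then have "da t + of_nat i + (da t + of_nat (Suc j)) = 0"
      unfolding wgamma_even wgamma_odd by (simp only: add.left_inverse)
    then have "2 * da t + of_nat (i + Suc j) = 0" by (simp add: algebra_simps)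
    then show False using da_ne_half[OF st, of "i + Suc j"] by simp
  qed
  have parity: "\<exists>i. k = 2 * i \<or> k = 2 * i + 1" for k :: nat by presburger
  obtain i j where ij: "m = 2 * i \<or> m = 2 * i + 1" "k = 2 * j \<or> k = 2 * j + 1"
    using parity by blast
  assume "wgamma t m = wgamma t k"
  with ij mixed[of i j] mixed[of j i]
  have "m = 2 * i \<and> k = 2 * j \<and> wgamma t (2 * i) = wgamma t (2 * j)
      \<or> m = 2 * i + 1 \<and> k = 2 * j + 1 \<and> wgamma t (2 * i + 1) = wgamma t (2 * j + 1)"
    by metis
  then show "m = k" unfolding wgamma_even wgamma_odd by auto
qed simp

lemma wgamma_square: "(da t + of_nat ((m + 1) div 2))^2 - (- wgamma t m)^2 = 0"
proof -
  have "wgamma t m = da t + of_nat ((m + 1) div 2) \<or> wgamma t m = - (da t + of_nat ((m + 1) div 2))"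
    by (cases "even m") (simp_all add: wgamma_def da_def add.commute[of "pt1 t"])
  then show ?thesis by (elim disjE) (simp_all only: power2_minus minus_minus diff_self)
qed

lemma wgamma_ne_da:
  assumes st: "standing_conditions t" and m: "m > 0"
  shows "- wgamma t m \<noteq> da t"
proof (cases "even m")
  case True
  then obtain n where n: "m = 2 * n" by (elim evenE)
  show ?thesis
  proof
    assume "- wgamma t m = da t"
    then have "- (da t + of_nat n) = da t" unfolding n wgamma_even .
    then have "2 * da t + of_nat n = 0" unfolding neg_eq_iff_add_eq_0 by (simp add: algebra_simps)
    then show False using da_ne_half[OF st, of n] m by (simp add: n)
  qed
next
  case False
  then obtain n where n: "m = 2 * n + 1" by (elim oddE)
  have "- wgamma t m = da t + of_nat (Suc n)" unfolding n wgamma_odd by (rule minus_minus)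
  then show ?thesis by (simp del: of_nat_Suc)
qed

lemma wpoly_eigen:
  assumes st: "standing_conditions t"
  shows "wilson_Y t (wpoly t m) = smult (wgamma t m) (wpoly t m)"
proof (cases "m = 0")
  \<comment> \<open>For \<open>m = 0\<close> the value \<open>l = da t\<close>, excluded in
    \<open>wsum_eigen_partial\<close>, occurs if \<open>da t = 0\<close>; but
    \<open>wpoly t 0\<close> is the constant \<open>1\<close>, whose difference quotients
    vanish.\<close>
  case True
  then show ?thesis
    by (intro poly_eqI_off_finite[of "{0, 1/2}"]) (simp_all add: wpoly_def poly_wilson_Y wgamma_def da_def del: insert_iff)
next
  case False
  show ?thesis
  proof (rule poly_eqI_off_finite[of "{0, 1/2}"])
    fix x :: complex assume "x \<notin> {0, 1/2}"
    from wsum_eigen_partial[OF st wgamma_ne_da[OF st] this, of m "(m + 1) div 2"] False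
    show "poly (wilson_Y t (wpoly t m)) x = poly (smult (wgamma t m) (wpoly t m)) x"
      unfolding wgamma_square wpoly_def[symmetric] by simp
  qed simp
qed

lemma degree_wterm_le: "degree (wterm t l k) \<le> 2 * k + 2"
proof -
  have "degree (wterm t l k) \<le> degree (wbase t k * [:wa t + of_nat k, 1:])
      + degree (smult (wcoeff t l (Suc k)) [:wa t, -1:] + smult (wcoeff' t l k) [:wb t, 1:])"
    unfolding wterm_def by (rule degree_mult_le)
  also have "\<dots> \<le> (2 * k + 1) + 1"
    by (intro add_mono order_trans[OF degree_mult_le] degree_add_le order_trans[OF degree_smult_le])
       (simp_all add: degree_wbase)
  finally show ?thesis by simp
qed

lemma degree_wsum_le: "degree (wsum t l n) \<le> 2 * n"
proof (induction n)
  case (Suc n)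
  then show ?case using degree_wterm_le[of t l n] by (auto simp: wsum_Suc intro!: degree_add_le)
qed simp

text \<open>The hypothesis keeps the last linear factor of \<open>wterm\<close> nonzero; whether its
  top coefficient vanishes decides the parity of the degree.\<close>

lemma degree_wterm:
  assumes "wcoeff t l (Suc k) * wa t + wcoeff' t l k * wb t \<noteq> 0 \<or> wcoeff' t l k \<noteq> wcoeff t l (Suc k)"
  shows "degree (wterm t l k) = (if wcoeff' t l k = wcoeff t l (Suc k) then 2 * k + 1 else 2 * k + 2)"
proof -
  have eq: "wterm t l k = wbase t k * [:wa t + of_nat k, 1:] *
     [:wcoeff t l (Suc k) * wa t + wcoeff' t l k * wb t, wcoeff' t l k - wcoeff t l (Suc k):]"
    by (simp add: wterm_def)
  have "wbase t k * [:wa t + of_nat k, 1:] \<noteq> 0" by (simp add: wbase_nonzero del: mult_pCons_right)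
  moreover have "degree (wbase t k * [:wa t + of_nat k, 1:]) = 2 * k + 1"
    by (subst degree_mult_eq) (simp_all add: wbase_nonzero degree_wbase)
  ultimately show ?thesis unfolding eq using assms
    by (subst degree_mult_eq) (auto simp del: mult_pCons_right)
qed

lemma wcoeff_nonzero:
  assumes st: "standing_conditions t"
    and "\<And>k. k < n \<Longrightarrow> da t + l + of_nat k \<noteq> 0" "\<And>k. k < n \<Longrightarrow> da t - l + of_nat k \<noteq> 0"
  shows "wcoeff t l n \<noteq> 0"
proof -
  have nz: "pochhammer z n \<noteq> 0" if "z \<notin> \<int>" for z :: complex
    using that by (auto simp: pochhammer_eq_0_iff)
  have "pochhammer (da t + l) n \<noteq> 0" "pochhammer (da t - l) n \<noteq> 0"
    using assms(2,3) by (auto simp: pochhammer_eq_0_iff eq_neg_iff_add_eq_0)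
  then show ?thesis
    using st by (auto simp: wcoeff_def standing_conditions_def nz)
qed

text \<open>The last pair determines the degree: for odd \<open>m\<close> its two coefficients
  coincide and the top power cancels, for even \<open>m\<close> they differ. The earlier pairs have
  smaller degree.\<close>

lemma degree_wpoly:
  assumes st: "standing_conditions t"
  shows "degree (wpoly t m) = m"
proof (cases "m = 0")
  case True
  then show ?thesis by (simp add: wpoly_def)
next
  case False
  define l where "l = - wgamma t m"
  define n where "n = (m - 1) div 2"
  have n: "(m + 1) div 2 = Suc n" using False by (simp add: n_def)
  have ab: "wa t + wb t = da t + db t" by (simp add: wa_def wb_def da_def db_def)
  have "wa t + wb t \<noteq> 0" using st by (auto simp: standing_conditions_def)
  have abN: "wa t + wb t + of_nat (Suc n) \<noteq> 0"
    using st unfolding standing_conditions_def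
    by (metis add.commute add_eq_0_iff Ints_minus Ints_of_nat)
  have "l \<noteq> da t" using wgamma_ne_da[OF st, of m] False by (simp add: l_def)
  then have al: "da t - l \<noteq> 0" by simp
  have "degree (wterm t l n) = m"
  proof (cases "even m")
    case True
    then have m: "m = 2 * n + 2" using False by (auto simp: n_def elim!: evenE)
    have l: "l = - (da t + of_nat (Suc n))" using wgamma_even[of t "Suc n"] by (simp add: l_def m)
    have K: "wcoeff t l (Suc n) \<noteq> 0"
    proof (rule wcoeff_nonzero[OF st])
      fix k assume k: "k < Suc n"
      then have "of_nat k - of_nat (Suc n) \<noteq> (0 :: complex)"
        unfolding right_minus_eq of_nat_eq_iff by simp
      then have "- of_nat (Suc n) + of_nat k \<noteq> (0 :: complex)" by (simp only: uminus_add_conv_diff not_False_eq_True)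
      moreover have "da t + l = - of_nat (Suc n)" unfolding l by (simp del: of_nat_Suc)
      ultimately show "da t + l + of_nat k \<noteq> 0" by (simp only: not_False_eq_True)
      show "da t - l + of_nat k \<noteq> 0" using da_ne_half[OF st, of "Suc n + k"] unfolding l by (simp add: algebra_simps)
    qed
    have "wcoeff' t l n \<noteq> wcoeff t l (Suc n)"
    proof
      assume "wcoeff' t l n = wcoeff t l (Suc n)"
      then have "wcoeff t l (Suc n) * (- (of_nat (Suc n) * (db t + l)))
          = wcoeff t l (Suc n) * ((da t - l) * (wa t + wb t + of_nat (Suc n)))"
        using al abN unfolding wcoeff'_def by (subst (asm) nonzero_divide_eq_eq) (simp_all add: mult_ac del: of_nat_Suc)
      then have "- (of_nat (Suc n) * (db t + l)) = (da t - l) * (wa t + wb t + of_nat (Suc n))"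
        using K by (simp only: mult_cancel_left simp_thms)
      then have "2 * ((wa t + wb t) * (da t + of_nat (Suc n))) = 0"
        unfolding l ab by (simp add: algebra_simps)
      with \<open>wa t + wb t \<noteq> 0\<close> da_ne_int[OF st, of "Suc n"] show False by (metis mult_eq_0_iff zero_less_Suc zero_neq_numeral)
    qed
    then show ?thesis by (subst degree_wterm) (auto simp: m)
  next
    case False
    then have m: "m = 2 * n + 1" by (auto simp: n_def elim!: oddE)
    have l: "l = da t + of_nat (Suc n)" using wgamma_odd[of t n] by (simp add: l_def m)
    have K: "wcoeff t l (Suc n) \<noteq> 0"
    proof (rule wcoeff_nonzero[OF st])
      fix k assume k: "k < Suc n"
      then have "of_nat k - of_nat (Suc n) \<noteq> (0 :: complex)"
        unfolding right_minus_eq of_nat_eq_iff by simp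
      then have "- of_nat (Suc n) + of_nat k \<noteq> (0 :: complex)" by (simp only: uminus_add_conv_diff not_False_eq_True)
      moreover have "da t - l = - of_nat (Suc n)" unfolding l by (simp del: of_nat_Suc)
      ultimately show "da t - l + of_nat k \<noteq> 0" by (simp only: not_False_eq_True)
      show "da t + l + of_nat k \<noteq> 0" using da_ne_half[OF st, of "Suc n + k"] unfolding l by (simp add: algebra_simps)
    qed
    have eq: "wcoeff' t l n = wcoeff t l (Suc n)"
      using abN by (simp add: wcoeff'_def l ab add_ac divide_simps del: of_nat_Suc)
    have "wcoeff t l (Suc n) * wa t + wcoeff' t l n * wb t = wcoeff t l (Suc n) * (wa t + wb t)"
      unfolding eq by (simp add: algebra_simps)
    then show ?thesis using K \<open>wa t + wb t \<noteq> 0\<close> eq by (subst degree_wterm) (auto simp: m)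
  qed
  moreover have "degree (wsum t l n) < m" using degree_wsum_le[of t l n] False by (simp add: n_def)
  ultimately show ?thesis
    unfolding wpoly_def n l_def[symmetric] wsum_Suc by (simp add: degree_add_eq_right)
qed

lemma wpoly_at_minus_a: "poly (wpoly t m) (- wa t) = 1"
  by (simp add: wpoly_def wsum_at_minus_a)

lemma wpoly_nonzero: "wpoly t m \<noteq> 0"
  using wpoly_at_minus_a[of t m] by auto

section \<open>Uniqueness of the eigenfunctions\<close>

text \<open>Remainder \<open>0\<close> is a separate case because its degree \<open>0\<close> is not
  below \<open>m\<close> when \<open>m = 0\<close>.\<close>

lemma reduce_degree_by_wpoly:
  assumes st: "standing_conditions t" and "degree q \<le> m"
  obtains k where "q = smult k (wpoly t m)" | k where "degree (q - smult k (wpoly t m)) < m"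
proof (cases "q = smult (coeff q m / lead_coeff (wpoly t m)) (wpoly t m)")
  case False
  let ?k = "coeff q m / lead_coeff (wpoly t m)"
  let ?r = "q - smult ?k (wpoly t m)"
  have "degree ?r \<le> m" using assms(2) by (intro degree_diff_le) (simp_all add: degree_wpoly[OF st])
  moreover have "coeff ?r m = 0"
    using wpoly_nonzero[of t m] by (simp add: degree_wpoly[OF st])
       (metis degree_wpoly[OF st] leading_coeff_0_iff)
  ultimately have "degree ?r < m"
    using False by (metis eq_iff_diff_eq_0 leading_coeff_0_iff le_neq_implies_less)
  then show ?thesis by (rule that(2))
qed (rule that(1))

text \<open>The \<open>wpoly\<close> supply an eigenfunction in every degree, so strong induction on
  the degree replaces a computation of \<open>Y\<close> on monomials.\<close>

lemma degree_wilson_Y_le: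
  assumes st: "standing_conditions t"
  shows "degree (wilson_Y t q) \<le> degree q"
proof (induction "degree q" arbitrary: q rule: less_induct)
  case less
  have P: "degree (wilson_Y t (smult k (wpoly t (degree q)))) \<le> degree q" for k
    by (simp add: wilson_Y_smult wpoly_eigen[OF st] degree_wpoly[OF st] order_trans[OF degree_smult_le])
  show ?case
  proof (rule reduce_degree_by_wpoly[OF st order.refl])
    fix k assume "q = smult k (wpoly t (degree q))"
    then show ?thesis using P[of k] by metis
  next
    fix k let ?r = "q - smult k (wpoly t (degree q))"
    assume r: "degree ?r < degree q"
    have "wilson_Y t q = wilson_Y t ?r + wilson_Y t (smult k (wpoly t (degree q)))"
      by (simp add: wilson_Y_add[symmetric])
    then show ?thesis using less[OF r] r P[of k] by (auto intro!: degree_add_le)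
  qed
qed

text \<open>
  Since \<open>Y\<close> does not raise degrees, applying \<open>Y - \<gamma>\<^sub>k\<close> to an eigenfunction of degree \<open>k\<close> with
  eigenvalue \<open>\<gamma>\<^sub>m \<noteq> \<gamma>\<^sub>k\<close> would lower its degree while only rescaling it.
\<close>

lemma wilson_eigenfunction_degree:
  assumes st: "standing_conditions t" and eig: "wilson_Y t q = smult (wgamma t m) q" and "q \<noteq> 0"
  shows "degree q = m"
proof (rule ccontr)
  assume "degree q \<noteq> m"
  define k where "k = degree q"
  with \<open>degree q \<noteq> m\<close> have ne: "wgamma t m - wgamma t k \<noteq> 0" using wgamma_inj[OF st, of m k] by auto
  \<comment> \<open>\<open>Y\<close> minus the scalar \<open>wgamma t k\<close> annihilates
    \<open>wpoly t k\<close>, so \<open>c\<close> is free here; it is later chosen to lower the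
    degree.\<close>
  have Yr: "wilson_Y t (q - smult c (wpoly t k)) - smult (wgamma t k) (q - smult c (wpoly t k))
      = smult (wgamma t m - wgamma t k) q" for c
    by (simp add: wilson_Y_diff wilson_Y_smult wpoly_eigen[OF st] eig smult_diff_right smult_diff_left mult_ac)
  show False
  proof (rule reduce_degree_by_wpoly[OF st, of q k])
    show "degree q \<le> k" by (simp add: k_def)
  next
    fix c assume "q = smult c (wpoly t k)"
    moreover have "wilson_Y t 0 = 0" using wilson_Y_smult[of t 0 0] by simp
    ultimately show False using Yr[of c] ne \<open>q \<noteq> 0\<close> by simp
  next
    fix c assume r: "degree (q - smult c (wpoly t k)) < k"
    have "degree (smult (wgamma t m - wgamma t k) q) < k"
      unfolding Yr[of c, symmetric]
    proof (rule degree_diff_less)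
      show "degree (wilson_Y t (q - smult c (wpoly t k))) < k"
        using degree_wilson_Y_le[OF st] r by (rule order.strict_trans1)
      show "degree (smult (wgamma t k) (q - smult c (wpoly t k))) < k"
        using degree_smult_le r by (rule order.strict_trans1)
    qed
    then show False using ne by (simp add: k_def)
  qed
qed

text \<open>Two monic solutions of degree \<open>m\<close> differ by a solution with coefficient
  \<open>0\<close> at \<open>m\<close>; were the difference nonzero, its degree would have to be
  \<open>m\<close>.\<close>

lemma wilson_poly_eq:
  assumes st: "standing_conditions t"
  shows "wilson_poly t m = smult (inverse (lead_coeff (wpoly t m))) (wpoly t m)"
  unfolding wilson_poly_def
proof (rule the_equality)
  let ?p = "smult (inverse (lead_coeff (wpoly t m))) (wpoly t m)"
  have "coeff (wpoly t m) m \<noteq> 0"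
    using wpoly_nonzero[of t m] degree_wpoly[OF st, of m] leading_coeff_0_iff by metis
  then have p: "lead_coeff ?p = 1" "degree ?p = m" "wilson_Y t ?p = smult (wgamma t m) ?p"
    by (simp_all add: degree_wpoly[OF st] wilson_Y_smult wpoly_eigen[OF st] mult_ac)
  then show "lead_coeff ?p = 1 \<and> degree ?p = m \<and> wilson_Y t ?p = smult (wgamma t m) ?p" by blast
  fix q assume q: "lead_coeff q = 1 \<and> degree q = m \<and> wilson_Y t q = smult (wgamma t m) q"
  show "q = ?p"
  proof (rule ccontr)
    assume "q \<noteq> ?p"
    moreover have "wilson_Y t (q - ?p) = smult (wgamma t m) (q - ?p)"
      using p(3) q by (simp only: wilson_Y_diff smult_diff_right)
    ultimately have "degree (q - ?p) = m" by (intro wilson_eigenfunction_degree[OF st]) auto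
    moreover have "coeff (q - ?p) m = 0" using p(1)[unfolded p(2)] q unfolding coeff_diff by auto
    ultimately show False using \<open>q \<noteq> ?p\<close> by (metis eq_iff_diff_eq_0 leading_coeff_0_iff)
  qed
qed

lemma wilson_E_eq:
  assumes st: "standing_conditions t"
  shows "wilson_E t x (wgamma t m) = poly (wpoly t m) x"
proof -
  have "(THE k. wgamma t k = wgamma t m) = m" using wgamma_inj[OF st] by auto
  then show ?thesis
    using wpoly_nonzero[of t m] by (simp add: wilson_E_def wilson_poly_eq[OF st] wpoly_at_minus_a)
qed

section \<open>Values of the Wilson function on the spectrum\<close>

lemma hyp4F3_terminating:
  assumes "a3 = - of_nat n \<or> a4 = - of_nat n"
  shows "hyp4F3 a1 a2 a3 a4 b1 b2 b3 1 =
    (\<Sum>k\<le>n. pochhammer a1 k * pochhammer a2 k * pochhammer a3 k * pochhammer a4 k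
       / (pochhammer b1 k * pochhammer b2 k * pochhammer b3 k * fact k))"
proof -
  have "pochhammer a3 k * pochhammer a4 k = 0" if "k > n" for k
    using assms that by (auto simp: pochhammer_of_nat_eq_0_iff)
  then show ?thesis
    unfolding hyp4F3_def eval_fps_def by (subst suminf_finite[of "{..n}"]) auto
qed

lemma Gamma_plus1':
  fixes z :: complex
  assumes "z \<notin> \<int>"
  shows "Gamma (z + 1) = z * Gamma z"
  using assms by (intro Gamma_plus1) (auto elim!: nonpos_Ints_cases)

text \<open>Accounts for the form of \<open>wcoeff'\<close>: the functional equation of
  \<open>Gamma\<close> absorbs the shift of \<open>a\<close> and \<open>b\<close> by
  \<open>1\<close>, and \<open>Gamma (1 - s) = - s * Gamma (- s)\<close> gives the minus
  sign.\<close>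

lemma wcoeff'_shift:
  assumes st: "standing_conditions t" and l: "l \<noteq> da t"
  shows "(da t + l) * (db t + l)
           * (Gamma (- wa t - wd t) / (Gamma (wa t + wb t + 2) * Gamma (wa t + wc t + 1)))
           * (pochhammer (da t + l + 1) k * pochhammer (da t - l + 1) k
              / (pochhammer (wa t + wb t + 2) k * pochhammer (wa t + wc t + 1) k
                 * pochhammer (wa t + wd t + 1) k * fact k))
         = Gamma (1 - wa t - wd t) / (Gamma (wa t + wb t) * Gamma (wa t + wc t)) * wcoeff' t l k"
proof -
  define p q s where "p = wa t + wb t" and "q = wa t + wc t" and "s = wa t + wd t"
  have nonint: "p \<notin> \<int>" "q \<notin> \<int>" "s \<notin> \<int>"
    using st by (simp_all add: p_def q_def s_def standing_conditions_def)
  then have nz: "p \<noteq> 0" "q \<noteq> 0" "s \<noteq> 0" by auto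
  have p1: "p + 1 \<notin> \<int>" using nonint(1) by simp
  then have p1_nz: "p + 1 \<noteq> 0" by (metis Ints_0)
  have pk: "p + of_nat (Suc k) \<noteq> 0"
    using nonint(1) by (metis add.commute add_eq_0_iff Ints_minus Ints_of_nat)
  have "p + 1 + 1 = p + 2" by simp
  then have Gp: "Gamma (p + 2) = (p + 1) * (p * Gamma p)"
    using Gamma_plus1'[OF p1] unfolding Gamma_plus1'[OF nonint(1)] by (simp only:)
  have Gq: "Gamma (q + 1) = q * Gamma q" by (rule Gamma_plus1'[OF nonint(2)])
  have "- s \<notin> \<int>" using nonint(3) by (metis Ints_minus minus_minus)
  from Gamma_plus1'[OF this] have Gs: "Gamma (1 - s) = - s * Gamma (- s)" by simp
  have G0: "Gamma p \<noteq> 0" "Gamma q \<noteq> 0"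
    using nonint by (auto simp: Gamma_eq_zero_iff elim!: nonpos_Ints_cases)
  \<comment> \<open>The factor \<open>p + of_nat (Suc k)\<close> in the denominator of
    \<open>wcoeff'\<close> completes \<open>pochhammer p (Suc k)\<close> to length
    \<open>k + 2\<close>, as \<open>a + b\<close> is raised by \<open>2\<close>.\<close>
  have "pochhammer p (Suc (Suc k)) = p * ((p + 1) * pochhammer (p + 1 + 1) k)"
    by (simp only: pochhammer_rec)
  then have Pp: "pochhammer p (Suc k) * (p + of_nat (Suc k)) = p * ((p + 1) * pochhammer (p + 2) k)"
    by (simp only: pochhammer_Suc add.assoc one_add_one)
  have poch_nz: "pochhammer z k \<noteq> 0" if "z \<notin> \<int>" for z :: complex
    using that by (auto simp: pochhammer_eq_0_iff)
  have P0: "pochhammer (p + 2) k \<noteq> 0" "pochhammer (q + 1) k \<noteq> 0" "pochhammer (s + 1) k \<noteq> 0"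
    using nonint by (simp_all add: poch_nz)
  have al: "da t - l \<noteq> 0" using l by simp
  have fk: "of_nat (Suc k) \<noteq> (0 :: complex)" by (simp del: of_nat_Suc)
  have W: "wcoeff' t l k = - ((db t + l) * ((da t + l) * pochhammer (da t + l + 1) k * pochhammer (da t - l + 1) k))
      / (p * (p + 1) * pochhammer (p + 2) k * (q * pochhammer (q + 1) k) * (s * pochhammer (s + 1) k) * fact k)"
  proof -
    have "wcoeff' t l k = - (of_nat (Suc k) * (db t + l) * ((da t + l) * pochhammer (da t + l + 1) k
         * ((da t - l) * pochhammer (da t - l + 1) k)
         / (pochhammer p (Suc k) * (q * pochhammer (q + 1) k) * (s * pochhammer (s + 1) k) * (of_nat (Suc k) * fact k))))
       / ((da t - l) * (p + of_nat (Suc k)))"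
      unfolding wcoeff'_def wcoeff_def p_def[symmetric] q_def[symmetric] s_def[symmetric]
      by (simp only: pochhammer_rec[of "da t + l"] pochhammer_rec[of "da t - l"] pochhammer_rec[of q]
            pochhammer_rec[of s] fact_Suc of_nat_mult)
    also have "\<dots> = - ((db t + l) * ((da t + l) * pochhammer (da t + l + 1) k * pochhammer (da t - l + 1) k))
       / ((pochhammer p (Suc k) * (p + of_nat (Suc k))) * (q * pochhammer (q + 1) k) * (s * pochhammer (s + 1) k) * fact k)"
      using al fk by (simp add: mult_ac del: of_nat_Suc pochhammer_Suc)
    finally show ?thesis unfolding Pp by (simp only: mult.assoc)
  qed
  have ms: "- wa t - wd t = - s" "1 - wa t - wd t = 1 - s" by (simp_all add: s_def)
  show ?thesis
    unfolding W ms p_def[symmetric] q_def[symmetric] s_def[symmetric] Gp Gq Gs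
    using nz p1_nz G0 P0 by (simp add: mult_ac)
qed

lemma wilson_fun_at_eigenvalue:
  assumes st: "standing_conditions t"
    and x: "1 - wd t + x \<notin> \<int>\<^sub>\<le>\<^sub>0" "1 - wd t - x \<notin> \<int>\<^sub>\<le>\<^sub>0"
  shows "wilson_fun t x (- wgamma t m) =
    Gamma (1 - wa t - wd t) / (Gamma (wa t + wb t) * Gamma (wa t + wc t)) * poly (wpoly t m) x"
proof -
  define l where "l = - wgamma t m"
  define n where "n = (m + 1) div 2"
  define G where "G = Gamma (1 - wa t - wd t) / (Gamma (wa t + wb t) * Gamma (wa t + wc t))"
  define g where "g = Gamma (1 - wd t + x) * Gamma (1 - wd t - x) * Gamma (1 - dd t + l) * Gamma (1 - dd t - l)"
  define rg where "rg = rGamma (1 - wd t + x) * rGamma (1 - wd t - x) * rGamma (1 - dd t + l) * rGamma (1 - dd t - l)"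
  have zero: "da t + l = - of_nat n \<or> da t - l = - of_nat n"
    by (cases "even m") (simp_all add: l_def n_def wgamma_def da_def)
  have m0: "da t + l = 0" if "n = 0"
    using that by (cases m) (simp_all add: n_def l_def wgamma_def da_def)
  \<comment> \<open>Up to integers the two arguments are \<open>- (wa t + wd t)\<close> and
    \<open>wb t + wc t\<close> in some order, and neither sum is an integer; so the outer Gamma
    factors in \<open>l\<close> have no poles.\<close>
  have "1 - dd t + l \<notin> \<int>" "1 - dd t - l \<notin> \<int>"
  proof -
    have ad: "wa t + wd t = da t + dd t" and bc: "wb t + wc t = 1 + da t - dd t"
      by (simp_all add: wa_def wd_def wb_def wc_def da_def dd_def)
    have "da t + dd t \<notin> \<int>" "1 + da t - dd t \<notin> \<int>"
      using st by (simp_all add: standing_conditions_def flip: ad bc)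
    then have ni: "1 - (da t + dd t) - of_nat n \<notin> \<int>" "1 + da t - dd t + of_nat n \<notin> \<int>"
      using Ints_diff[of "1 - of_nat n" "1 - (da t + dd t) - of_nat n"]
        Ints_diff[of "1 + da t - dd t + of_nat n" "of_nat n"]
      by (auto simp: algebra_simps)
    from zero have "l = - (da t + of_nat n) \<or> l = da t + of_nat n"
    proof
      assume "da t + l = - of_nat n"
      then have "l = - of_nat n - da t" by (simp only: eq_diff_eq add.commute)
      then show ?thesis by simp
    next
      assume "da t - l = - of_nat n"
      then have "l = da t - - of_nat n" by (metis add_diff_cancel_left' diff_add_cancel)
      then show ?thesis by simp
    qed
    then have "1 - dd t + l = 1 - (da t + dd t) - of_nat n \<and> 1 - dd t - l = 1 + da t - dd t + of_nat n
      \<or> 1 - dd t + l = 1 + da t - dd t + of_nat n \<and> 1 - dd t - l = 1 - (da t + dd t) - of_nat n"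
      by auto
    with ni show "1 - dd t + l \<notin> \<int>" "1 - dd t - l \<notin> \<int>" by metis+
  qed
  then have "1 - dd t + l \<notin> \<int>\<^sub>\<le>\<^sub>0" "1 - dd t - l \<notin> \<int>\<^sub>\<le>\<^sub>0" by (auto elim!: nonpos_Ints_cases)
  moreover have GrG: "Gamma z * rGamma z = 1" if "z \<notin> \<int>\<^sub>\<le>\<^sub>0" for z :: complex
    using that by (simp add: rGamma_inverse_Gamma Gamma_eq_zero_iff)
  moreover have "g * rg = (Gamma (1 - wd t + x) * rGamma (1 - wd t + x)) * (Gamma (1 - wd t - x) * rGamma (1 - wd t - x))
      * (Gamma (1 - dd t + l) * rGamma (1 - dd t + l)) * (Gamma (1 - dd t - l) * rGamma (1 - dd t - l))"
    by (simp only: g_def rg_def mult_ac)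
  ultimately have grg: "g * rg = 1" using x by (simp only: simp_thms mult_1_left)
  have phi: "wilson_phi t l x = G * rg *
      (\<Sum>k\<le>n. wcoeff t l k * (pochhammer (wa t + x) k * pochhammer (wa t - x) k))"
  proof -
    \<comment> \<open>The vanishing factor annihilates the second summand whatever value its
      infinite series is assigned.\<close>
    have "rGamma (da t + l) = 0 \<or> rGamma (da t - l) = 0" using zero by auto
    moreover have "hyp4F3 (wa t + x) (wa t - x) (da t + l) (da t - l) (wa t + wb t) (wa t + wc t) (wa t + wd t) 1
        = (\<Sum>k\<le>n. wcoeff t l k * (pochhammer (wa t + x) k * pochhammer (wa t - x) k))"
      unfolding hyp4F3_terminating[OF zero] by (intro sum.cong) (simp_all add: wcoeff_def)
    ultimately show ?thesis by (auto simp: wilson_phi_def Let_def G_def rg_def)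
  qed
  have phi': "(da t + l) * (db t + l) * wilson_phi (shift1 t) l x = G * rg *
      (\<Sum>k<n. wcoeff' t l k * (pochhammer (wa t + 1 + x) k * pochhammer (wa t + 1 - x) k))"
  proof (cases n)
    \<comment> \<open>The shifted series need not terminate here, but the prefactor
      \<open>da t + l\<close> vanishes, in agreement with the empty sum.\<close>
    case 0
    then show ?thesis using m0 by simp
  next
    case (Suc n')
    then have "m > 0" by (simp add: n_def split: nat.splits)
    then have ne: "l \<noteq> da t" unfolding l_def by (rule wgamma_ne_da[OF st])
    \<comment> \<open>Raising \<open>da t\<close> by \<open>1\<close> shortens the series by one
      term: the indices run up to \<open>n'\<close>, that is, below \<open>n\<close>.\<close>
    have zero': "da t + 1 + l = - of_nat n' \<or> da t + 1 - l = - of_nat n'"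
    proof -
      have "da t + 1 + l = (da t + l) + 1" "da t + 1 - l = (da t - l) + 1" by simp_all
      with zero show ?thesis by (elim disjE) (simp_all add: Suc)
    qed
    define H where "H = Gamma (- wa t - wd t) / (Gamma (wa t + wb t + 2) * Gamma (wa t + wc t + 1))"
    have sh: "1 - (wa t + 1) - wd t = - wa t - wd t" "wa t + 1 + (wb t + 1) = wa t + wb t + 2"
      "wa t + 1 + wc t = wa t + wc t + 1" "wa t + 1 + wd t = wa t + wd t + 1"
      by simp_all
    have "rGamma (da t + 1 + l) = 0 \<or> rGamma (da t + 1 - l) = 0" using zero' by auto
    then have "wilson_phi (shift1 t) l x = H * rg * hyp4F3 (wa t + 1 + x) (wa t + 1 - x) (da t + 1 + l) (da t + 1 - l)
        (wa t + wb t + 2) (wa t + wc t + 1) (wa t + wd t + 1) 1"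
      unfolding wilson_phi_def Let_def params_shift1 sh H_def rg_def by auto
    also have "\<dots> = H * rg * (\<Sum>k<n. pochhammer (wa t + 1 + x) k * pochhammer (wa t + 1 - x) k
        * (pochhammer (da t + l + 1) k * pochhammer (da t - l + 1) k
              / (pochhammer (wa t + wb t + 2) k * pochhammer (wa t + wc t + 1) k
                 * pochhammer (wa t + wd t + 1) k * fact k)))"
      unfolding hyp4F3_terminating[OF zero'] Suc lessThan_Suc_atMost
      by (intro arg_cong2[where f = "(*)"] sum.cong refl)
         (simp only: times_divide_eq_right mult.assoc add.assoc add.commute[of 1] diff_add_eq)
    finally have "(da t + l) * (db t + l) * wilson_phi (shift1 t) l x =
      rg * (\<Sum>k<n. pochhammer (wa t + 1 + x) k * pochhammer (wa t + 1 - x) k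
        * ((da t + l) * (db t + l) * H * (pochhammer (da t + l + 1) k * pochhammer (da t - l + 1) k
              / (pochhammer (wa t + wb t + 2) k * pochhammer (wa t + wc t + 1) k
                 * pochhammer (wa t + wd t + 1) k * fact k))))"
      by (simp add: sum_distrib_left mult_ac)
    then show ?thesis
      unfolding H_def wcoeff'_shift[OF st ne] G_def[symmetric]
      by (simp add: sum_distrib_left mult_ac)
  qed
  have "wilson_fun t x l = g * (wilson_phi t l x + (wa t + x) * (wb t + x)
      * ((da t + l) * (db t + l) * wilson_phi (shift1 t) l x))"
    by (simp add: wilson_fun_def g_def mult_ac)
  also have "\<dots> = (g * rg) * (G * poly (wsum t l n) x)"
    unfolding phi phi' poly_wsum by (simp add: distrib_left mult_ac)
  finally show ?thesis
    unfolding grg by (simp add: G_def wpoly_def l_def n_def)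
qed

section \<open>Duality\<close>

text \<open>The combinations in \<open>e\<close> are self-dual and the numerator parameters are only
  permuted, so both series agree term by term for all \<open>x\<close> and \<open>l\<close>.\<close>

lemma wilson_phi_sigma: "wilson_phi (wsigma t) x l = wilson_phi t l x"
proof -
  have e: "da t + db t = wa t + wb t" "da t + dc t = wa t + wc t"
    "da t + dd t = wa t + wd t" "1 + db t - dd t = 1 + wb t - wd t" "1 + dc t - dd t = 1 + wc t - wd t"
    "1 - da t - dd t = 1 - wa t - wd t" "2 - da t - dd t = 2 - wa t - wd t" "da t + dd t - 1 = wa t + wd t - 1"
    by (simp_all add: dual_params_sigma wa_def wb_def wc_def wd_def da_def db_def dc_def dd_def)
  show ?thesis
    unfolding wilson_phi_def Let_def dual_params_sigma e
    by (simp add: hyp4F3_def eval_fps_def hyp4F3_reg_def mult_ac)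
qed

lemma wilson_fun_sigma: "wilson_fun (wsigma t) l x = wilson_fun t x l"
proof -
  \<comment> \<open>\<open>wsigma\<close> fixes the third parameter, the only one that
    \<open>shift1\<close> changes.\<close>
  have "shift1 (wsigma t) = wsigma (shift1 t)" by (simp add: shift1_def wsigma_def)
  then show ?thesis
    by (simp add: wilson_fun_def wilson_phi_sigma dual_params_sigma mult_ac)
qed

section \<open>Removable singularities in \<open>x\<close>\<close>

text \<open>The nonpositive integers without \<open>f x\<close> still form a closed set, which
  \<open>f\<close> avoids near \<open>x\<close>; injectivity excludes the value \<open>f x\<close>
  itself.\<close>

lemma eventually_at_notin_nonpos_Ints:
  fixes f :: "complex \<Rightarrow> complex"
  assumes "continuous (at x) f" "inj f"
  shows "\<forall>\<^sub>F y in at x. f y \<notin> \<int>\<^sub>\<le>\<^sub>0"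
proof -
  have op: "open (- (\<int>\<^sub>\<le>\<^sub>0 - {f x}))"
    by (intro open_Compl closed_subset_Ints) (auto elim!: nonpos_Ints_cases)
  have "(f \<longlongrightarrow> f x) (at x)" using assms(1) by (simp add: continuous_at)
  from topological_tendstoD[OF this op] have "\<forall>\<^sub>F y in at x. f y \<in> - (\<int>\<^sub>\<le>\<^sub>0 - {f x})"
    by simp
  moreover have "\<forall>\<^sub>F y in at x. y \<noteq> x" by (simp add: eventually_at_filter)
  ultimately show ?thesis
    by eventually_elim (use assms(2) in \<open>auto dest: injD\<close>)
qed

theorem theorem5p12:
  fixes t :: wparams
  assumes "standing_conditions t"
  shows "(\<forall>g \<in> {- wgamma t m | m. True}.
            (\<forall>x. 1 - wd t + x \<notin> \<int>\<^sub>\<le>\<^sub>0 \<and> 1 - wd t - x \<notin> \<int>\<^sub>\<le>\<^sub>0 \<longrightarrow>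
               wilson_fun t x g =
                 Gamma (1 - wa t - wd t) / (Gamma (wa t + wb t) * Gamma (wa t + wc t))
                 * wilson_E t x (- g)) \<and>
            (\<forall>x. ((\<lambda>y. wilson_fun t y g) \<longlongrightarrow>
                 Gamma (1 - wa t - wd t) / (Gamma (wa t + wb t) * Gamma (wa t + wc t))
                 * wilson_E t x (- g)) (at x)))
         \<and> (\<forall>x l. wilson_fun t x l = wilson_fun (wsigma t) l x)"
proof (intro conjI ballI allI impI)
  fix g x assume "g \<in> {- wgamma t m | m. True}"
  then obtain m where g: "g = - wgamma t m" by blast
  have E: "wilson_E t y (- g) = poly (wpoly t m) y" for y
    unfolding g minus_minus by (rule wilson_E_eq[OF assms])
  show *: "wilson_fun t y g = Gamma (1 - wa t - wd t) / (Gamma (wa t + wb t) * Gamma (wa t + wc t))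
      * wilson_E t y (- g)" if "1 - wd t + y \<notin> \<int>\<^sub>\<le>\<^sub>0 \<and> 1 - wd t - y \<notin> \<int>\<^sub>\<le>\<^sub>0" for y
    unfolding E unfolding g using that by (intro wilson_fun_at_eigenvalue[OF assms]) auto
  \<comment> \<open>Near every \<open>x\<close>, including those where \<open>Gamma\<close> takes
    its default value \<open>0\<close> at a pole, the function agrees off \<open>x\<close> with a
    continuous polynomial expression; this gives the limit.\<close>
  have "\<forall>\<^sub>F y in at x. 1 - wd t + y \<notin> \<int>\<^sub>\<le>\<^sub>0" "\<forall>\<^sub>F y in at x. 1 - wd t - y \<notin> \<int>\<^sub>\<le>\<^sub>0"
    by (intro eventually_at_notin_nonpos_Ints continuous_intros injI; simp)+
  then have "\<forall>\<^sub>F y in at x. Gamma (1 - wa t - wd t) / (Gamma (wa t + wb t) * Gamma (wa t + wc t))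
      * poly (wpoly t m) y = wilson_fun t y g"
    by eventually_elim (simp add: * E)
  moreover have "((\<lambda>y. Gamma (1 - wa t - wd t) / (Gamma (wa t + wb t) * Gamma (wa t + wc t)) * poly (wpoly t m) y)
     \<longlongrightarrow> Gamma (1 - wa t - wd t) / (Gamma (wa t + wb t) * Gamma (wa t + wc t)) * poly (wpoly t m) x) (at x)"
    by (intro tendsto_mult tendsto_const poly_isCont[unfolded isCont_def])
  ultimately show "((\<lambda>y. wilson_fun t y g) \<longlongrightarrow>
      Gamma (1 - wa t - wd t) / (Gamma (wa t + wb t) * Gamma (wa t + wc t)) * wilson_E t x (- g)) (at x)"
    unfolding E by (rule Lim_transform_eventually[rotated])
qed (rule wilson_fun_sigma[symmetric])

end
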